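(* Let $E,w_1,\dots,w_n$ be positive integers satisfying $E<\sum_{i=1}^n w_i$, and let $\boldsymbol{w}=(w_1,\dots,w_n)$. Let $\phi$ be the Shapley value of the bankruptcy game $\mathrm{BG}[E;\boldsymbol{w}]$ and, for each integer $q$ with $1\le q\le E$, let $\varphi^{\langle q\rangle}$ be the Shapley–Shubik index of the weighted voting game $\mathrm{WVG}[q;\boldsymbol{w}]$. Then $$\phi=\sum_{q=1}^{E}\varphi^{\langle q\rangle}.$$
   Context: Let $N=\{1,\dots,n\}$. The bankruptcy game $\mathrm{BG}[E;\boldsymbol{w}]$ (with $0<E<\sum_{i\in N}w_i$) is the cooperative game $(N,v)$ with $v(S)=\max\{0,\,E-\sum_{i\in N\setminus S}w_i\}$ for all $S\subseteq N$. For a positive integer $q\le\sum_{i\in N}w_i$, the weighted voting game $\mathrm{WVG}[q;\boldsymbol{w}]$ is the game $(N,v^{\langle q\rangle})$ with $v^{\langle q\rangle}(S)=1$ if $S\ne\emptyset$ and $\sum_{i\in S}w_i\ge q$, and $v^{\langle q\rangle}(S)=0$ otherwise. A permutation of $N$ is a bijection $\pi:\{1,\dots,n\}\to N$; $\Pi_N$ is the set of all of them; $\mathrm{Prc}(\pi,i)$ is the set of players preceding $i$ in $\pi$. The Shapley value of a game $(N,u)$ is the vector with components $\frac{1}{n!}\sum_{\pi\in\Pi_N}\bigl(u(\mathrm{Prc}(\pi,i)\cup\{i\})-u(\mathrm{Prc}(\pi,i))\bigr)$, $i\in N$. The Shapley–Shubik index of a weighted voting game is its Shapley value. *)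

theory Defs
  imports Complex_Main "HOL-Combinatorics.Permutations"
begin

text \<open>
  The player set is \<open>N = {1..n}\<close>. A game on \<open>N\<close> is given by \<open>n\<close> together with its
  characteristic function, of which only the values on subsets of \<open>{1..n}\<close> matter.
\<close>
type_synonym game = "nat set \<Rightarrow> real"

definition bankruptcy_game :: "nat \<Rightarrow> nat \<Rightarrow> (nat \<Rightarrow> nat) \<Rightarrow> game" where
  "bankruptcy_game n E w S = max 0 (real E - (\<Sum>i\<in>{1..n} - S. real (w i)))"

definition weighted_voting_game :: "nat \<Rightarrow> (nat \<Rightarrow> nat) \<Rightarrow> game" where
  "weighted_voting_game q w S = (if S \<noteq> {} \<and> (\<Sum>i\<in>S. w i) \<ge> q then 1 else 0)"

text \<open>
  A bijection \<open>\<pi>\<close> from \<open>{1..n}\<close> to \<open>N = {1..n}\<close> is represented by its unique extension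
  with \<open>\<pi> permutes {1..n}\<close>; \<open>\<pi> k\<close> is the player in position \<open>k\<close>, so \<open>inv \<pi> i\<close> is
  the position of player \<open>i\<close>.
\<close>
definition Prc :: "nat \<Rightarrow> (nat \<Rightarrow> nat) \<Rightarrow> nat \<Rightarrow> nat set" where
  "Prc n \<pi> i = {j \<in> {1..n}. inv \<pi> j < inv \<pi> i}"

definition shapley_value :: "nat \<Rightarrow> game \<Rightarrow> nat \<Rightarrow> real" where
  "shapley_value n u i =
     1 / fact n * (\<Sum>\<pi> | \<pi> permutes {1..n}. u (Prc n \<pi> i \<union> {i}) - u (Prc n \<pi> i))"

definition shapley_shubik_index :: "nat \<Rightarrow> nat \<Rightarrow> (nat \<Rightarrow> nat) \<Rightarrow> nat \<Rightarrow> real" where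
  "shapley_shubik_index n q w = shapley_value n (weighted_voting_game q w)"

end

theory Submission
  imports Defs
begin

text \<open>
  Summing the weighted voting games over \<open>q = 1, \<dots>, E\<close> gives the game
  \<open>u(S) = min(E, w(S))\<close>, whose dual \<open>S \<mapsto> u(N) - u(N - S)\<close> is the bankruptcy game.
  The Shapley value is linear, and it is invariant under duality because reversing the order
  of the players exchanges predecessors and successors.
\<close>

text \<open>Fixing everything outside \<open>{1..n}\<close> makes this a permutation in the sense of
  \<open>permutes\<close>, so it composes with orders of the players.\<close>

definition reversal :: "nat \<Rightarrow> nat \<Rightarrow> nat" where
  "reversal n k = (if k \<in> {1..n} then n + 1 - k else k)"

lemma reversal_reversal: "reversal n (reversal n k) = k"
  by (auto simp: reversal_def)

lemma reversal_permutes: "reversal n permutes {1..n}"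
proof (rule bij_imp_permutes)
  show "bij_betw (reversal n) {1..n} {1..n}"
    by (rule bij_betw_byWitness[where f' = "reversal n"])
      (auto simp: reversal_reversal, auto simp: reversal_def)
qed (auto simp: reversal_def)

lemma inv_reversal: "inv (reversal n) = reversal n"
  by (rule inv_unique_comp) (auto simp: fun_eq_iff reversal_reversal)

text \<open>Composing on the right acts on positions: a player at position \<open>k\<close> moves to
  \<open>n + 1 - k\<close>, so the new predecessors of \<open>i\<close> are its old
  successors.\<close>

lemma Prc_reversal:
  assumes "\<pi> permutes {1..n}" and "i \<in> {1..n}"
  shows "Prc n (\<pi> \<circ> reversal n) i = {1..n} - (Prc n \<pi> i \<union> {i})"
proof -
  have inv: "inv (\<pi> \<circ> reversal n) = reversal n \<circ> inv \<pi>"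
    using o_inv_distrib[OF permutes_bij[OF assms(1)] permutes_bij[OF reversal_permutes]]
    by (simp add: inv_reversal)
  have "reversal n (inv \<pi> j) < reversal n (inv \<pi> i) \<longleftrightarrow> \<not> inv \<pi> j < inv \<pi> i \<and> j \<noteq> i"
    if "j \<in> {1..n}" for j
  proof -
    \<comment> \<open>On \<open>{1..n}\<close> the reversal is strictly decreasing; injectivity of
      \<open>inv \<pi>\<close> leaves \<open>j = i\<close> as the only tie.\<close>
    have "inv \<pi> j \<in> {1..n}" "inv \<pi> i \<in> {1..n}"
      using that assms permutes_in_image[OF permutes_inv[OF assms(1)]] by blast+
    moreover have "inv \<pi> j = inv \<pi> i \<longleftrightarrow> j = i"
      using permutes_inj[OF permutes_inv[OF assms(1)]] by (auto dest: injD)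
    ultimately show ?thesis
      by (auto simp: reversal_def)
  qed
  then show ?thesis
    by (auto simp: Prc_def inv)
qed

lemma shapley_value_dual:
  assumes "i \<in> {1..n}"
  shows "shapley_value n (\<lambda>S. u {1..n} - u ({1..n} - S)) i = shapley_value n u i"
proof -
  let ?N = "{1..n}"
  have dual: "(u ?N - u (?N - (Prc n \<pi> i \<union> {i}))) - (u ?N - u (?N - Prc n \<pi> i))
      = u (Prc n (\<pi> \<circ> reversal n) i \<union> {i}) - u (Prc n (\<pi> \<circ> reversal n) i)"
    if "\<pi> permutes ?N" for \<pi>
  proof -
    \<comment> \<open>Player \<open>i\<close> lies in \<open>?N\<close> and does not precede
      itself.\<close>
    have "?N - (Prc n \<pi> i \<union> {i}) \<union> {i} = ?N - Prc n \<pi> i"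
      using assms unfolding Prc_def by blast
    then show ?thesis
      unfolding Prc_reversal[OF that assms] by simp
  qed
  have "(\<Sum>\<pi> | \<pi> permutes ?N. u (Prc n \<pi> i \<union> {i}) - u (Prc n \<pi> i))
      = (\<Sum>\<pi> | \<pi> permutes ?N.
          u (Prc n (\<pi> \<circ> reversal n) i \<union> {i}) - u (Prc n (\<pi> \<circ> reversal n) i))"
    by (rule sum_permutations_compose_right[OF reversal_permutes])
  also have "\<dots> = (\<Sum>\<pi> | \<pi> permutes ?N.
      (u ?N - u (?N - (Prc n \<pi> i \<union> {i}))) - (u ?N - u (?N - Prc n \<pi> i)))"
    by (rule sum.cong[OF refl], rule dual[symmetric], erule CollectD)
  finally show ?thesis
    unfolding shapley_value_def by (simp only:)
qed

lemma shapley_value_sum: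
  "shapley_value n (\<lambda>S. \<Sum>q\<in>A. u q S) i = (\<Sum>q\<in>A. shapley_value n (u q) i)"
  unfolding shapley_value_def sum_subtractf[symmetric] sum_distrib_left
  by (rule sum.swap)

text \<open>The sum counts the quotas in \<open>{1..E}\<close> that the weight of \<open>S\<close>
  reaches.\<close>

lemma sum_weighted_voting_game:
  "(\<Sum>q=1..E. weighted_voting_game q w S) = real (min E (\<Sum>i\<in>S. w i))"
proof -
  have "(\<Sum>q=1..E. weighted_voting_game q w S) = (\<Sum>q=1..E. if q \<le> (\<Sum>i\<in>S. w i) then 1 else 0)"
    by (rule sum.cong) (auto simp: weighted_voting_game_def)
  also have "\<dots> = real (card {q \<in> {1..E}. q \<le> (\<Sum>i\<in>S. w i)})"
    by (simp flip: sum.inter_filter)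
  also have "{q \<in> {1..E}. q \<le> (\<Sum>i\<in>S. w i)} = {1..min E (\<Sum>i\<in>S. w i)}"
    by auto
  finally show ?thesis
    by simp
qed

text \<open>The hypothesis turns the first minimum into \<open>E\<close>, and
  \<open>E - min E x = max 0 (E - x)\<close> over the reals.\<close>

lemma bankruptcy_game_eq_dual:
  assumes "E \<le> (\<Sum>i=1..n. w i)"
  shows "bankruptcy_game n E w S
       = real (min E (\<Sum>i=1..n. w i)) - real (min E (\<Sum>i\<in>{1..n} - S. w i))"
  using assms by (auto simp: bankruptcy_game_def min_def max_def simp flip: of_nat_sum)

theorem theorem4p2:
  fixes n E :: nat and w :: "nat \<Rightarrow> nat"
  assumes "E > 0"
    and "\<And>i. i \<in> {1..n} \<Longrightarrow> w i > 0"
    and "E < (\<Sum>i=1..n. w i)"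
  shows "\<forall>i\<in>{1..n}. shapley_value n (bankruptcy_game n E w) i =
           (\<Sum>q=1..E. shapley_shubik_index n q w i)"
proof
  fix i assume i: "i \<in> {1..n}"
  let ?u = "\<lambda>S. \<Sum>q=1..E. weighted_voting_game q w S"
  have "bankruptcy_game n E w = (\<lambda>S. ?u {1..n} - ?u ({1..n} - S))"
    unfolding sum_weighted_voting_game using assms(3) by (intro ext bankruptcy_game_eq_dual) simp
  then have "shapley_value n (bankruptcy_game n E w) i = shapley_value n ?u i"
    using shapley_value_dual[OF i] by simp
  then show "shapley_value n (bankruptcy_game n E w) i = (\<Sum>q=1..E. shapley_shubik_index n q w i)"
    by (simp add: shapley_value_sum shapley_shubik_index_def)
qed

end
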